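(* Let $G$ be a graph of girth $g\in\{5,6\}$ and minimum degree $\delta\geq 2$. Then $$Z(G)\geq (g-2)(\delta-2)+2.$$
   Context: All graphs are finite, simple and undirected; the girth is the length of a shortest cycle. For a set $Z\subseteq V(G)$, let $\mathcal{F}(Z)$ be the set obtained from $Z$ by repeatedly adding a vertex $u$ outside the current set whenever $u$ is the unique neighbor outside the current set of some vertex in the current set, as long as possible. $Z$ is a zero forcing set of $G$ if $\mathcal{F}(Z)=V(G)$. The zero forcing number $Z(G)$ is the minimum cardinality of a zero forcing set of $G$. *)

theory Defs
  imports "Graph_Theory.Graph_Theory" "HOL-Library.Extended_Nat"
begin

text \<open>
  A finite simple undirected graph is a \<^locale>\<open>pair_graph\<close>: a finite vertex set with a symmetric,
  irreflexive set of ordered pairs, each edge $uv$ being represented by both \<^term>\<open>(u, v)\<close> and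
  \<^term>\<open>(v, u)\<close>.
\<close>

definition neighborhood :: "'a pair_pre_digraph \<Rightarrow> 'a \<Rightarrow> 'a set" where
  "neighborhood G v = {u. (v, u) \<in> parcs G}"

definition min_degree :: "'a pair_pre_digraph \<Rightarrow> nat" where
  "min_degree G = Min ((\<lambda>v. card (neighborhood G v)) ` pverts G)"

text \<open>
  In a symmetric digraph every edge gives a directed cycle \<^term>\<open>[(u, v), (v, u)]\<close> in the sense of
  \<^const>\<open>pre_digraph.cycle\<close>; requiring length at least 3 removes exactly these degenerate cycles.
  The girth of an acyclic graph is \<^term>\<open>\<infinity>\<close>.
\<close>

definition girth :: "'a pair_pre_digraph \<Rightarrow> enat" where
  "girth G = (INF p\<in>{p. pre_digraph.cycle (with_proj G) p \<and> 3 \<le> length p}. enat (length p))"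

inductive force_step :: "'a pair_pre_digraph \<Rightarrow> 'a set \<Rightarrow> 'a set \<Rightarrow> bool" for G where
  "v \<in> S \<Longrightarrow> neighborhood G v - S = {u} \<Longrightarrow> force_step G S (insert u S)"

text \<open>
  The description below determines the set uniquely for every finite graph and every set of
  vertices; see \<open>forcing_closure_unique\<close>.
\<close>

definition forcing_closure :: "'a pair_pre_digraph \<Rightarrow> 'a set \<Rightarrow> 'a set" where
  "forcing_closure G Z = (THE S. (force_step G)\<^sup>*\<^sup>* Z S \<and> (\<nexists>T. force_step G S T))"

definition zero_forcing_set :: "'a pair_pre_digraph \<Rightarrow> 'a set \<Rightarrow> bool" where
  "zero_forcing_set G Z \<longleftrightarrow> Z \<subseteq> pverts G \<and> forcing_closure G Z = pverts G"

definition zero_forcing_number :: "'a pair_pre_digraph \<Rightarrow> nat" where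
  "zero_forcing_number G = Min (card ` {Z. zero_forcing_set G Z})"

lemma force_steps_subset_terminal:
  assumes "(force_step G)\<^sup>*\<^sup>* Z S" "Z \<subseteq> T" "\<nexists>U. force_step G T U"
  shows "S \<subseteq> T"
  using assms(1)
proof (induction rule: rtranclp_induct)
  case base
  show ?case by (rule assms(2))
next
  case (step S S')
  from step.hyps(2) obtain v u
    where vu: "v \<in> S" "neighborhood G v - S = {u}" "S' = insert u S"
    by (auto elim: force_step.cases)
  have "u \<in> T"
  proof (rule ccontr)
    assume "u \<notin> T"
    with vu step.IH have "neighborhood G v - T = {u}" by blast
    with vu(1) step.IH have "force_step G T (insert u T)"
      by (blast intro: force_step.intros)
    with assms(3) show False by blast
  qed
  with vu step.IH show ?case by blast
qed

lemma force_steps_mono: "(force_step G)\<^sup>*\<^sup>* Z S \<Longrightarrow> Z \<subseteq> S"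
  by (induction rule: rtranclp_induct) (auto elim: force_step.cases)

lemma forcing_closure_unique:
  assumes "pair_graph G" "Z \<subseteq> pverts G"
  shows "\<exists>!S. (force_step G)\<^sup>*\<^sup>* Z S \<and> (\<nexists>T. force_step G S T)"
proof -
  interpret pair_graph G by (rule assms(1))
  have "\<exists>S. (force_step G)\<^sup>*\<^sup>* Z S \<and> (\<nexists>T. force_step G S T)"
    using assms(2)
  proof (induction "card (pverts G - Z)" arbitrary: Z rule: less_induct)
    case less
    show ?case
    proof (cases "\<exists>T. force_step G Z T")
      case False
      then show ?thesis by blast
    next
      case True
      then obtain v u where vu: "v \<in> Z" "neighborhood G v - Z = {u}"
        and st: "force_step G Z (insert u Z)"
        by (auto elim!: force_step.cases intro: force_step.intros)
      have u: "u \<in> pverts G - Z"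
        using vu(2) in_arcsD2 unfolding neighborhood_def by blast
      then have "card (pverts G - insert u Z) < card (pverts G - Z)"
        by (intro psubset_card_mono) (auto simp: pair_finite_verts)
      with less u obtain S
        where "(force_step G)\<^sup>*\<^sup>* (insert u Z) S" "\<nexists>T. force_step G S T"
        by blast
      with st show ?thesis by (meson converse_rtranclp_into_rtranclp)
    qed
  qed
  then show ?thesis
    by (metis force_steps_mono force_steps_subset_terminal subset_antisym)
qed

end

theory Submission
  imports Defs
begin

text \<open>
  A vertex that has forced has its whole closed neighbourhood inside the current set, and no vertex
  forces twice. After $k$ forces, the current set thus has $|Z| + k$ elements and contains the closed
  neighbourhoods of $k$ distinct vertices. With $k = g - 2$ it remains to see that the closed
  neighbourhoods of any three (respectively four) vertices cover at least $3\delta - 1$ (respectively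
  $4\delta - 2$) vertices in girth 5 (respectively 6), which follows by inclusion-exclusion, splitting
  on whether two of the given vertices are adjacent. If fewer than $k$ forces take place, then
  $|Z| > n - k$, and any $k$ vertices serve the same purpose.
\<close>

abbreviation closed_nbh :: "'a pair_pre_digraph \<Rightarrow> 'a \<Rightarrow> 'a set" where
  "closed_nbh G v \<equiv> insert v (neighborhood G v)"

section \<open>Forcing sequences\<close>

text \<open>\<open>U\<close> collects the vertices that have forced. When \<open>v\<close> forces
  \<open>w\<close>, all other neighbours of \<open>v\<close> are already in the set, so its closed
  neighbourhood is complete afterwards.\<close>

lemma force_step_relpowp:
  assumes "(force_step G ^^ k) Z S" "finite Z"
  shows "finite S \<and> card S = card Z + k \<and>
    (\<exists>U. card U = k \<and> finite U \<and> U \<subseteq> S \<and> (\<Union>u\<in>U. closed_nbh G u) \<subseteq> S)"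
  using assms
proof (induction k arbitrary: S)
  case 0
  then show ?case by (auto intro!: exI[of _ "{}"])
next
  case (Suc k)
  then obtain R where R: "(force_step G ^^ k) Z R" "force_step G R S" by auto
  from Suc.IH[OF R(1) Suc.prems(2)] obtain U where
    U: "finite R" "card R = card Z + k" "card U = k" "finite U" "U \<subseteq> R"
      "(\<Union>u\<in>U. closed_nbh G u) \<subseteq> R" by blast
  from R(2) obtain v w where vw: "v \<in> R" "neighborhood G v - R = {w}" "S = insert w R"
    by (auto elim: force_step.cases)
  have "w \<notin> R" using vw by auto
  \<comment> \<open>\<open>v\<close> still has the neighbour \<open>w\<close> outside
    \<open>R\<close>, whereas the closed neighbourhoods of the vertices of \<open>U\<close> lie in
    \<open>R\<close>.\<close>
  moreover have "v \<notin> U" using vw U by auto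
  moreover have "closed_nbh G v \<subseteq> S" using vw by auto
  ultimately have "card S = card Z + Suc k" "card (insert v U) = Suc k" "finite (insert v U)"
     "insert v U \<subseteq> S" "(\<Union>u\<in>insert v U. closed_nbh G u) \<subseteq> S"
    using U vw by auto
  then show ?case using U vw by blast
qed

lemma zero_forcing_set_reachable:
  assumes "pair_graph G" "zero_forcing_set G Z"
  shows "(force_step G)\<^sup>*\<^sup>* Z (pverts G)"
  using theI'[OF forcing_closure_unique[OF assms(1), of Z]] assms(2)
  unfolding zero_forcing_set_def forcing_closure_def by auto

context pair_graph
begin

lemma neighborhood_subset: "neighborhood G v \<subseteq> pverts G"
  unfolding neighborhood_def using in_arcsD2 by blast

lemma neighborhood_sym: "u \<in> neighborhood G v \<Longrightarrow> v \<in> neighborhood G u"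
  unfolding neighborhood_def using sym_arcs[unfolded symmetric_def] by (auto dest: symD arcs_symmetric)

lemma not_in_neighborhood [simp]: "v \<notin> neighborhood G v"
  unfolding neighborhood_def using no_loops' by blast

lemma finite_neighborhood [simp]: "finite (neighborhood G v)"
  using finite_subset[OF neighborhood_subset pair_finite_verts] .

lemma zero_forcing_set_card_ge:
  assumes "zero_forcing_set G Z" "k \<le> card (pverts G)"
    and cover: "\<And>U. U \<subseteq> pverts G \<Longrightarrow> card U = k \<Longrightarrow> m \<le> card (\<Union>u\<in>U. closed_nbh G u)"
  shows "m \<le> card Z + k"
proof -
  have Z: "Z \<subseteq> pverts G" "finite Z"
    using assms(1) pair_finite_verts finite_subset unfolding zero_forcing_set_def by blast+
  obtain n where n: "(force_step G ^^ n) Z (pverts G)"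
    using zero_forcing_set_reachable[OF pair_graph_axioms assms(1)] by (meson rtranclp_imp_relpowp)
  show ?thesis
  proof (cases "k \<le> n")
    case True
    then obtain j where j: "n = k + j" using le_Suc_ex by blast
    then have "(force_step G ^^ k OO force_step G ^^ j) Z (pverts G)" using n by (metis relpowp_add)
    then obtain S where S: "(force_step G ^^ k) Z S" "(force_step G ^^ j) S (pverts G)" by blast
    have "S \<subseteq> pverts G" using S(2) force_steps_mono by (metis relpowp_imp_rtranclp)
    with force_step_relpowp[OF S(1) Z(2)] cover show ?thesis
      by (metis card_mono le_trans subset_trans)
  next
    case False
    \<comment> \<open>Fewer than \<open>k\<close> forces fill the graph, so the whole vertex set, of
      size \<open>card Z + n\<close>, takes the place of the intermediate set.\<close>
    obtain U where U: "U \<subseteq> pverts G" "card U = k" using assms(2) obtain_subset_with_card_n by metis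
    have "(\<Union>u\<in>U. closed_nbh G u) \<subseteq> pverts G" using U neighborhood_subset by blast
    then have "m \<le> card (pverts G)" using cover[OF U] pair_finite_verts by (meson card_mono le_trans)
    also have "\<dots> = card Z + n" using force_step_relpowp[OF n Z(2)] by blast
    finally show ?thesis using False by simp
  qed
qed

lemma zero_forcing_number_ge:
  assumes "k \<le> card (pverts G)"
    and "\<And>U. U \<subseteq> pverts G \<Longrightarrow> card U = k \<Longrightarrow> m \<le> card (\<Union>u\<in>U. closed_nbh G u)"
  shows "m \<le> zero_forcing_number G + k"
proof -
  let ?C = "card ` {Z. zero_forcing_set G Z}"
  \<comment> \<open>No force leaves the full vertex set, so it is zero forcing and
    \<open>Min\<close> ranges over a nonempty set.\<close>
  have "\<nexists>T. force_step G (pverts G) T"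
    using neighborhood_subset by (fastforce elim: force_step.cases)
  then have "forcing_closure G (pverts G) = pverts G"
    unfolding forcing_closure_def
    by (intro the1_equality[OF forcing_closure_unique[OF pair_graph_axioms subset_refl]]) simp
  then have "?C \<noteq> {}" unfolding zero_forcing_set_def by blast
  moreover have "finite {Z. zero_forcing_set G Z}"
    by (rule finite_subset[of _ "Pow (pverts G)"]) (auto simp: zero_forcing_set_def pair_finite_verts)
  ultimately have "Min ?C \<in> ?C" by (intro Min_in) auto
  then show ?thesis
    unfolding zero_forcing_number_def using zero_forcing_set_card_ge[OF _ assms] by auto
qed

section \<open>Girth\<close>

lemma girth_le_cycle:
  assumes "pre_digraph.cycle (with_proj G) p" "3 \<le> length p"
  shows "girth G \<le> enat (length p)"
  unfolding girth_def using assms by (intro INF_lower) auto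

lemma no_triangle:
  assumes "enat 4 \<le> girth G" "b \<in> neighborhood G a" "c \<in> neighborhood G b"
  shows "c \<notin> neighborhood G a"
proof
  assume c: "c \<in> neighborhood G a"
  have "pre_digraph.cycle (with_proj G) [(a,b),(b,c),(c,a)]"
    using assms neighborhood_sym[OF c] in_arcsD1 in_arcsD2
    unfolding cycle_def awalk_def neighborhood_def
    by (auto dest: pair_no_loops)
  from girth_le_cycle[OF this] assms(1) show False
    by (auto dest: order_trans)
qed

lemma no_four_cycle:
  assumes "enat 5 \<le> girth G" "a \<noteq> c"
    "x \<in> neighborhood G a" "x \<in> neighborhood G c" "y \<in> neighborhood G a" "y \<in> neighborhood G c"
  shows "x = y"
proof (rule ccontr)
  assume "x \<noteq> y"
  have "pre_digraph.cycle (with_proj G) [(a,x),(x,c),(c,y),(y,a)]"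
    using assms neighborhood_sym[OF assms(4)] neighborhood_sym[OF assms(5)] in_arcsD1 in_arcsD2 \<open>x \<noteq> y\<close>
    unfolding cycle_def awalk_def neighborhood_def
    by (auto dest: pair_no_loops)
  from girth_le_cycle[OF this] assms(1) show False
    by (auto dest: order_trans)
qed

text \<open>Distinctness is automatic: a degenerate closed walk of length 5 contains a triangle.\<close>

lemma no_five_walk:
  assumes "enat 6 \<le> girth G" "b \<in> neighborhood G a" "c \<in> neighborhood G b"
    "d \<in> neighborhood G c" "e \<in> neighborhood G d"
  shows "e \<notin> neighborhood G a"
proof
  assume e: "e \<in> neighborhood G a"
  have g: "enat 4 \<le> girth G" using assms(1) by (rule order_trans[rotated]) simp
  note nt = no_triangle[OF g]
  have ne: "a \<noteq> c" "a \<noteq> d" "b \<noteq> d" "b \<noteq> e" "c \<noteq> e"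
    using nt assms e by (meson neighborhood_sym)+
  have "pre_digraph.cycle (with_proj G) [(a,b),(b,c),(c,d),(d,e),(e,a)]"
    using assms neighborhood_sym[OF e] in_arcsD1 in_arcsD2 ne
    unfolding cycle_def awalk_def neighborhood_def
    by (auto dest: pair_no_loops)
  from girth_le_cycle[OF this] assms(1) show False
    by (auto dest: order_trans)
qed

text \<open>Guarantees that there are \<open>g - 2\<close> distinct vertices for the covering
  argument. A finite girth comes from an actual cycle, which visits as many distinct vertices as it
  has arcs.\<close>

lemma girth_le_card_verts:
  assumes "girth G = enat g"
  shows "g \<le> card (pverts G)"
proof -
  obtain p where p: "cycle p" "3 \<le> length p"
  proof -
    have "{p. cycle p \<and> 3 \<le> length p} \<noteq> {}"
    proof
      assume "{p. cycle p \<and> 3 \<le> length p} = {}"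
      with assms show False unfolding girth_def by (simp add: top_enat_def)
    qed
    with that show ?thesis by blast
  qed
  then obtain u where u: "awalk u p u" "distinct (tl (pawalk_verts u p))"
    unfolding cycle_def by auto
  have "g \<le> length p" using girth_le_cycle[OF p] assms by simp
  \<comment> \<open>A closed walk lists its start vertex at both ends; dropping the head leaves one
    vertex per arc.\<close>
  also have "\<dots> = card (set (tl (pawalk_verts u p)))"
    using u(2) length_awalk_verts[of u p] by (simp add: distinct_card)
  also have "set (tl (pawalk_verts u p)) \<subseteq> pverts G"
    using u(1) by (cases p) (auto elim!: awalkE)
  then have "card (set (tl (pawalk_verts u p))) \<le> card (pverts G)"
    by (intro card_mono pair_finite_verts)
  finally show ?thesis .
qed

section \<open>Closed neighbourhoods in graphs of girth at least 5\<close>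

lemma card_Int_Un_le: "card (A \<inter> (B \<union> C)) \<le> card (A \<inter> B) + card (A \<inter> C)"
  by (metis Int_Un_distrib card_Un_le)

lemma card_closed_nbh: "min_degree G + 1 \<le> card (closed_nbh G v)" if "v \<in> pverts G"
  unfolding min_degree_def using that pair_finite_verts by simp

lemma closed_nbh_Int_adjacent:
  assumes "enat 4 \<le> girth G" "b \<in> neighborhood G a"
  shows "closed_nbh G a \<inter> closed_nbh G b = {a, b}"
  using no_triangle[OF assms] assms(2) neighborhood_sym by blast

text \<open>Only common neighbours can lie in the intersection, and two of them would close a
  4-cycle.\<close>

lemma card_closed_nbh_Int_nonadjacent:
  assumes "enat 5 \<le> girth G" "a \<noteq> b" "b \<notin> neighborhood G a"
  shows "card (closed_nbh G a \<inter> closed_nbh G b) \<le> 1"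
proof -
  have "closed_nbh G a \<inter> closed_nbh G b = neighborhood G a \<inter> neighborhood G b"
    using assms neighborhood_sym by blast
  then show ?thesis using no_four_cycle[OF assms(1,2)] by (auto simp: card_le_Suc0_iff_eq)
qed

lemma card_closed_nbh_Int:
  assumes "enat 5 \<le> girth G" "a \<noteq> b"
  shows "card (closed_nbh G a \<inter> closed_nbh G b) \<le> 2"
proof (cases "b \<in> neighborhood G a")
  case True
  have "enat 4 \<le> girth G" using assms(1) by (rule order_trans[rotated]) simp
  from closed_nbh_Int_adjacent[OF this True] show ?thesis by (simp add: card_insert_if)
next
  case False
  then show ?thesis using card_closed_nbh_Int_nonadjacent[OF assms] by simp
qed

text \<open>The closed neighbourhoods of \<open>b\<close> and \<open>c\<close> meet only in their
  common neighbour \<open>a\<close>, so \<open>b\<close> adds nothing to the overlap of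
  \<open>c\<close> with \<open>a\<close>.\<close>

lemma closed_nbh_Int_edge_adjacent:
  assumes "enat 5 \<le> girth G" "b \<in> neighborhood G a" "c \<in> neighborhood G a" "b \<noteq> c"
  shows "closed_nbh G c \<inter> (closed_nbh G a \<union> closed_nbh G b) = {a, c}"
proof -
  have g: "enat 4 \<le> girth G" using assms(1) by (rule order_trans[rotated]) simp
  have "b \<notin> neighborhood G c" "c \<notin> neighborhood G b"
    using no_triangle[OF g assms(2)] assms(3) neighborhood_sym by blast+
  moreover have "x = a" if "x \<in> neighborhood G c" "x \<in> neighborhood G b" for x
    using no_four_cycle[OF assms(1) assms(4), of x a] that assms neighborhood_sym by blast
  ultimately have "closed_nbh G c \<inter> closed_nbh G b = {a}"
    using assms neighborhood_sym by blast
  then show ?thesis using closed_nbh_Int_adjacent[OF g assms(3)] by blast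
qed

text \<open>If \<open>c\<close> is adjacent to an end of the edge, the overlap consists of that end
  and \<open>c\<close>; otherwise each end contributes at most one common neighbour.\<close>

lemma card_closed_nbh_Int_edge:
  assumes "enat 5 \<le> girth G" "b \<in> neighborhood G a" "c \<noteq> a" "c \<noteq> b"
  shows "card (closed_nbh G c \<inter> (closed_nbh G a \<union> closed_nbh G b)) \<le> 2"
proof -
  consider "c \<in> neighborhood G a" | "c \<in> neighborhood G b"
    | "a \<notin> neighborhood G c" "b \<notin> neighborhood G c"
    using neighborhood_sym by blast
  then show ?thesis
  proof cases
    case 1
    show ?thesis
      unfolding closed_nbh_Int_edge_adjacent[OF assms(1,2) 1 assms(4)[symmetric]]
      by (simp add: card_insert_if)
  next
    case 2
    show ?thesis
      unfolding Un_commute[of "closed_nbh G a"]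
        closed_nbh_Int_edge_adjacent[OF assms(1) neighborhood_sym[OF assms(2)] 2 assms(3)[symmetric]]
      by (simp add: card_insert_if)
  next
    case 3
    then show ?thesis
      using card_Int_Un_le[of "closed_nbh G c" "closed_nbh G a" "closed_nbh G b"]
        card_closed_nbh_Int_nonadjacent[OF assms(1,3)]
        card_closed_nbh_Int_nonadjacent[OF assms(1,4)] by linarith
  qed
qed

text \<open>Overlaps with both ends would give the closed 5-walk \<open>a b y c x\<close>, so only
  one end contributes.\<close>

lemma card_closed_nbh_Int_edge_nonadjacent:
  assumes "enat 6 \<le> girth G" "b \<in> neighborhood G a" "c \<noteq> a" "c \<noteq> b"
    "c \<notin> neighborhood G a" "c \<notin> neighborhood G b"
  shows "card (closed_nbh G c \<inter> (closed_nbh G a \<union> closed_nbh G b)) \<le> 1"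
proof -
  have g: "enat 5 \<le> girth G" using assms(1) by (rule order_trans[rotated]) simp
  let ?A = "closed_nbh G c \<inter> closed_nbh G a" and ?B = "closed_nbh G c \<inter> closed_nbh G b"
  have "?A = {} \<or> ?B = {}"
  proof (rule ccontr)
    assume "\<not> ?thesis"
    then obtain x y where "x \<in> neighborhood G c" "x \<in> neighborhood G a"
      "y \<in> neighborhood G c" "y \<in> neighborhood G b"
      using assms neighborhood_sym by blast
    then show False
      using no_five_walk[OF assms(1), of b a y c x] assms(2) neighborhood_sym by blast
  qed
  moreover have "card ?A \<le> 1" "card ?B \<le> 1"
    using g assms neighborhood_sym by (intro card_closed_nbh_Int_nonadjacent; blast)+
  ultimately show ?thesis by (metis Int_Un_distrib sup_bot.left_neutral sup_bot.right_neutral)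
qed

section \<open>Lower bounds for unions of closed neighbourhoods\<close>

lemma card_closed_nbh_edge:
  assumes "enat 4 \<le> girth G" "a \<in> pverts G" "b \<in> neighborhood G a"
  shows "2 * min_degree G \<le> card (closed_nbh G a \<union> closed_nbh G b)"
proof -
  have "b \<in> pverts G" using assms(3) neighborhood_subset by blast
  moreover have "a \<noteq> b" using assms(3) by auto
  ultimately show ?thesis
    using card_Un_Int[of "closed_nbh G a" "closed_nbh G b"] closed_nbh_Int_adjacent[OF assms(1,3)]
      card_closed_nbh[OF assms(2)] card_closed_nbh[of b] by simp
qed

lemma card_Un_Int_ge:
  assumes "finite A" "finite B" "card (A \<inter> B) \<le> k"
  shows "card A + card B \<le> card (A \<union> B) + k"
  using card_Un_Int[OF assms(1,2)] assms(3) by simp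

text \<open>With an edge \<open>ab\<close>, the union has at least 2 delta + (delta + 1) - 2
  elements. Without edges, the three pairwise overlaps cost at most 1 each, leaving 3 (delta + 1) -
  3.\<close>

lemma card_closed_nbh_three:
  assumes g: "enat 5 \<le> girth G" and U: "U \<subseteq> pverts G" "card U = 3"
  shows "3 * min_degree G - 1 \<le> card (\<Union>u\<in>U. closed_nbh G u)"
proof (cases "\<exists>a\<in>U. \<exists>b\<in>U. b \<in> neighborhood G a")
  case True
  then obtain a b where ab: "a \<in> U" "b \<in> U" "b \<in> neighborhood G a" by blast
  then have "a \<noteq> b" by auto
  have "card (U - {a, b}) = 1" using U ab \<open>a \<noteq> b\<close> by (simp add: card_Diff_subset)
  then obtain c where c: "U - {a, b} = {c}" by (auto simp: card_1_singleton_iff)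
  have "c \<noteq> a" "c \<noteq> b" "c \<in> pverts G" and Ueq: "U = {a, b, c}" using c ab U by blast+
  have g4: "enat 4 \<le> girth G" using g by (rule order_trans[rotated]) simp
  have "2 * min_degree G \<le> card (closed_nbh G a \<union> closed_nbh G b)"
    using card_closed_nbh_edge[OF g4 _ ab(3)] ab U by blast
  moreover have "card (closed_nbh G c) + card (closed_nbh G a \<union> closed_nbh G b)
      \<le> card (closed_nbh G c \<union> (closed_nbh G a \<union> closed_nbh G b)) + 2"
    by (intro card_Un_Int_ge card_closed_nbh_Int_edge) (use g ab c in auto)
  moreover have "(\<Union>u\<in>U. closed_nbh G u) = closed_nbh G c \<union> (closed_nbh G a \<union> closed_nbh G b)"
    unfolding Ueq by blast
  ultimately show ?thesis using card_closed_nbh[OF \<open>c \<in> pverts G\<close>] by simp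
next
  case False
  obtain a b c where abc: "U = {a, b, c}" "a \<noteq> b" "a \<noteq> c" "b \<noteq> c"
    using U(2) by (auto simp: card_3_iff)
  have i: "card (closed_nbh G u \<inter> closed_nbh G v) \<le> 1" if "u \<in> U" "v \<in> U" "u \<noteq> v" for u v
    using card_closed_nbh_Int_nonadjacent[OF g] that False by blast
  let ?A = "closed_nbh G a" and ?B = "closed_nbh G b" and ?C = "closed_nbh G c"
  have "card ?A + card ?B \<le> card (?A \<union> ?B) + 1"
    by (intro card_Un_Int_ge i) (use abc in auto)
  moreover have "card (?C \<inter> (?A \<union> ?B)) \<le> 1 + 1"
    by (intro order_trans[OF card_Int_Un_le] add_mono i) (use abc in auto)
  then have "card ?C + card (?A \<union> ?B) \<le> card (?C \<union> (?A \<union> ?B)) + 2"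
    by (intro card_Un_Int_ge) auto
  moreover have "(\<Union>u\<in>U. closed_nbh G u) = ?C \<union> (?A \<union> ?B)"
    unfolding abc(1) by blast
  ultimately show ?thesis
    using card_closed_nbh[of a] card_closed_nbh[of b] card_closed_nbh[of c] U(1) abc(1) by simp
qed

text \<open>
  If \<open>c\<close> and \<open>d\<close> are both adjacent to the edge \<open>ab\<close>, then no vertex outside the closed
  neighbourhoods of \<open>a\<close> and \<open>b\<close> lies in those of both \<open>c\<close> and \<open>d\<close>, so the three overlaps sum to at
  most 4 in all cases.
\<close>

lemma card_overlaps_edge:
  assumes g: "enat 6 \<le> girth G" and b: "b \<in> neighborhood G a"
    and ne: "c \<noteq> a" "c \<noteq> b" "d \<noteq> a" "d \<noteq> b" "c \<noteq> d"
  defines "E \<equiv> closed_nbh G a \<union> closed_nbh G b"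
  shows "card (closed_nbh G c \<inter> E) + card (closed_nbh G d \<inter> E)
    + card (closed_nbh G c \<inter> closed_nbh G d - E) \<le> 4"
proof -
  have g5: "enat 5 \<le> girth G" using g by (rule order_trans[rotated]) simp
  have g4: "enat 4 \<le> girth G" using g by (rule order_trans[rotated]) simp
  let ?I = "closed_nbh G c \<inter> closed_nbh G d"
  have c2: "card (closed_nbh G c \<inter> E) \<le> 2" and d2: "card (closed_nbh G d \<inter> E) \<le> 2"
    unfolding E_def using card_closed_nbh_Int_edge[OF g5 b] ne by blast+
  \<comment> \<open>As \<open>c\<close> differs from \<open>a\<close> and \<open>b\<close>, lying
    outside \<open>E\<close> means being adjacent to neither.\<close>
  have c1: "card (closed_nbh G c \<inter> E) \<le> 1" if "c \<notin> E"
    using that card_closed_nbh_Int_edge_nonadjacent[OF g b] ne unfolding E_def by blast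
  have d1: "card (closed_nbh G d \<inter> E) \<le> 1" if "d \<notin> E"
    using that card_closed_nbh_Int_edge_nonadjacent[OF g b] ne unfolding E_def by blast
  have I2: "card (?I - E) \<le> 2"
    using card_closed_nbh_Int[OF g5 ne(5)] by (meson Diff_subset card_mono finite_Int finite_insert finite_neighborhood le_trans)
  \<comment> \<open>If \<open>c\<close> and \<open>d\<close> are adjacent, then \<open>?I\<close> is
    \<open>{c, d}\<close> and \<open>E\<close> removes one of the two; otherwise \<open>?I\<close>
    itself has at most one element.\<close>
  have I1: "card (?I - E) \<le> 1" if cd: "c \<in> E \<or> d \<in> E"
  proof (cases "d \<in> neighborhood G c")
    case True
    then have "?I - E \<subseteq> {c} \<or> ?I - E \<subseteq> {d}" using closed_nbh_Int_adjacent[OF g4 True] cd by blast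
    then show ?thesis by (metis card.empty card_insert_disjoint card_mono empty_iff finite.emptyI finite.insertI One_nat_def)
  next
    case False
    then show ?thesis
      using card_closed_nbh_Int_nonadjacent[OF g5 ne(5) False]
      by (meson Diff_subset card_mono finite_Int finite_insert finite_neighborhood le_trans)
  qed
  have I0: "?I - E = {}" if "c \<in> E" "d \<in> E"
  proof -
    \<comment> \<open>If \<open>c\<close> and \<open>d\<close> hang on the same end
      \<open>u\<close>, their only common neighbour is \<open>u\<close>, which lies in
      \<open>E\<close>.\<close>
    have same: "x = u" if "c \<in> neighborhood G u" "d \<in> neighborhood G u" "x \<in> ?I" "x \<noteq> c" "x \<noteq> d" for x u
      using that no_four_cycle[OF g5 ne(5), of x u] neighborhood_sym by blast
    \<comment> \<open>If they hang on different ends, a further common neighbour \<open>x\<close>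
      closes the 5-walk \<open>a' b' d x c\<close>.\<close>
    have nonadj: False
      if "b' \<in> neighborhood G a'" "c \<in> neighborhood G a'" "d \<in> neighborhood G b'" "x \<in> ?I" "x \<noteq> c" "x \<noteq> d"
      for a' b' x
      using that no_five_walk[OF g, of b' a' d x c] neighborhood_sym by blast
    show ?thesis
      using that same[of a] same[of b] nonadj[of b a] nonadj[of a b] b neighborhood_sym[OF b] ne
      unfolding E_def by blast
  qed
  have "card (?I - E) = 0" if "c \<in> E" "d \<in> E" using I0[OF that] by simp
  \<comment> \<open>According to whether both, one or none of \<open>c\<close> and \<open>d\<close>
    lie in \<open>E\<close>, the bounds add up to 2 + 2 + 0, 2 + 1 + 1 or 1 + 1 + 2.\<close>
  then show ?thesis using c1 d1 c2 d2 I1 I2 by linarith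
qed

text \<open>With an edge, the union has at least 2 delta + 2 (delta + 1) - 4 elements. Without
  edges, the six pairwise overlaps cost at most 1 each, leaving 4 (delta + 1) - 6, the same
  value.\<close>

lemma card_closed_nbh_four:
  assumes g: "enat 6 \<le> girth G" and U: "U \<subseteq> pverts G" "card U = 4"
  shows "4 * min_degree G - 2 \<le> card (\<Union>u\<in>U. closed_nbh G u)"
proof (cases "\<exists>a\<in>U. \<exists>b\<in>U. b \<in> neighborhood G a")
  case True
  then obtain a b where ab: "a \<in> U" "b \<in> U" "b \<in> neighborhood G a" by blast
  then have "a \<noteq> b" by auto
  have "card (U - {a, b}) = 2" using U ab \<open>a \<noteq> b\<close> by (simp add: card_Diff_subset)
  then obtain c d where cd: "U - {a, b} = {c, d}" "c \<noteq> d" by (auto simp: card_2_iff)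
  have ne: "c \<noteq> a" "c \<noteq> b" "d \<noteq> a" "d \<noteq> b" "c \<in> pverts G" "d \<in> pverts G"
    and Ueq: "U = {a, b, c, d}" using cd ab U by blast+
  have g4: "enat 4 \<le> girth G" using g by (rule order_trans[rotated]) simp
  define E where "E = closed_nbh G a \<union> closed_nbh G b"
  let ?C = "closed_nbh G c" and ?D = "closed_nbh G d"
  have fin: "finite E" unfolding E_def by simp
  have "2 * min_degree G \<le> card E"
    unfolding E_def using card_closed_nbh_edge[OF g4 _ ab(3)] ab U by blast
  moreover have "card (?C \<inter> E) + card (?D \<inter> E) + card (?C \<inter> ?D - E) \<le> 4"
    unfolding E_def by (rule card_overlaps_edge[OF g ab(3) ne(1-4) cd(2)])
  moreover have "card ?C + card E = card (?C \<union> E) + card (?C \<inter> E)"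
    using fin by (intro card_Un_Int) auto
  moreover have "card ?D + card (?C \<union> E) = card (?D \<union> (?C \<union> E)) + card (?D \<inter> (?C \<union> E))"
    using fin by (intro card_Un_Int) auto
  \<comment> \<open>Removing \<open>E\<close> from the overlap of \<open>?C\<close> and
    \<open>?D\<close> avoids counting vertices of \<open>E\<close> twice.\<close>
  moreover have "?D \<inter> (?C \<union> E) = (?D \<inter> E) \<union> (?C \<inter> ?D - E)" by blast
  then have "card (?D \<inter> (?C \<union> E)) \<le> card (?D \<inter> E) + card (?C \<inter> ?D - E)" by (metis card_Un_le)
  moreover have "(\<Union>u\<in>U. closed_nbh G u) = ?D \<union> (?C \<union> E)"
    unfolding Ueq E_def by blast
  ultimately show ?thesis using card_closed_nbh[OF ne(5)] card_closed_nbh[OF ne(6)] by simp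
next
  case False
  have g5: "enat 5 \<le> girth G" using g by (rule order_trans[rotated]) simp
  obtain d V where V: "U = insert d V" "d \<notin> V" "card V = 3"
    using U(2) by (metis card_Suc_eq numeral_3_eq_3 eval_nat_numeral(2) semiring_norm(26,27))
  obtain a b c where abc: "V = {a, b, c}" "a \<noteq> b" "a \<noteq> c" "b \<noteq> c"
    using V(3) by (auto simp: card_3_iff)
  have i: "card (closed_nbh G u \<inter> closed_nbh G v) \<le> 1" if "u \<in> U" "v \<in> U" "u \<noteq> v" for u v
    using card_closed_nbh_Int_nonadjacent[OF g5] that False by blast
  let ?A = "closed_nbh G a" and ?B = "closed_nbh G b" and ?C = "closed_nbh G c" and ?D = "closed_nbh G d"
  have "card ?A + card ?B \<le> card (?A \<union> ?B) + 1"
    by (intro card_Un_Int_ge i) (use V abc in auto)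
  moreover have "card (?C \<inter> (?A \<union> ?B)) \<le> 1 + 1"
    by (intro order_trans[OF card_Int_Un_le] add_mono i) (use V abc in auto)
  then have "card ?C + card (?A \<union> ?B) \<le> card (?C \<union> (?A \<union> ?B)) + 2"
    by (intro card_Un_Int_ge) auto
  moreover have "card (?D \<inter> (?C \<union> (?A \<union> ?B))) \<le> 1 + (1 + 1)"
    by (intro order_trans[OF card_Int_Un_le] add_mono i order_trans[OF card_Int_Un_le[of ?D ?A ?B]])
      (use V abc in auto)
  then have "card ?D + card (?C \<union> (?A \<union> ?B)) \<le> card (?D \<union> (?C \<union> (?A \<union> ?B))) + 3"
    by (intro card_Un_Int_ge) auto
  moreover have "(\<Union>u\<in>U. closed_nbh G u) = ?D \<union> (?C \<union> (?A \<union> ?B))"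
    unfolding V(1) abc(1) by blast
  ultimately show ?thesis
    using card_closed_nbh[of a] card_closed_nbh[of b] card_closed_nbh[of c] card_closed_nbh[of d]
      U(1) V(1) abc(1) by simp
qed

end

theorem theorem4:
  fixes G :: "'a pair_pre_digraph" and g \<delta> :: nat
  assumes "pair_graph G"
    and "girth G = enat g" and "g \<in> {5, 6}"
    and "min_degree G = \<delta>" and "\<delta> \<ge> 2"
  shows "zero_forcing_number G \<ge> (g - 2) * (\<delta> - 2) + 2"
proof -
  interpret pair_graph G by (rule assms(1))
  have n: "g \<le> card (pverts G)" by (rule girth_le_card_verts[OF assms(2)])
  from assms(3) consider "g = 5" | "g = 6" by blast
  \<comment> \<open>With k = g - 2 forces, 3 delta - 1 - 3 = 3 (delta - 2) + 2 and 4 delta - 2 - 4 =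
    4 (delta - 2) + 2; as delta is at least 2, no natural subtraction truncates.\<close>
  then show ?thesis
  proof cases
    case 1
    then have "3 * \<delta> - 1 \<le> zero_forcing_number G + 3"
      using n assms(2,4) card_closed_nbh_three by (intro zero_forcing_number_ge) simp_all
    with 1 assms(5) show ?thesis by simp
  next
    case 2
    then have "4 * \<delta> - 2 \<le> zero_forcing_number G + 4"
      using n assms(2,4) card_closed_nbh_four by (intro zero_forcing_number_ge) simp_all
    with 2 assms(5) show ?thesis by simp
  qed
qed

end
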